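(* Every graph $G$ has two disjoint independent isolating sets. Indeed, $G$ has disjoint sets of vertices $X$ and $Y$ such that $X$ is an independent dominating set of $G$ and $Y$ is an independent isolating set of $G$.
   Context: Graphs are finite and simple. For a set $S$ of vertices of $G$, $N[S]$ denotes $S$ together with all neighbors of vertices of $S$. A set $S\subseteq V(G)$ is an isolating set of $G$ if $G-N[S]$ contains no edge. An independent isolating set is an isolating set that is also an independent set. An independent dominating set is an independent set $S$ such that every vertex not in $S$ has a neighbor in $S$. *)

theory Defs
  imports "Graph_Theory.Digraph_Component"
begin

text \<open>
  A finite simple graph is an instance of the locale \<^locale>\<open>graph\<close>: a finite digraph without loops
  or parallel arcs whose adjacency relation \<open>u \<rightarrow>\<^bsub>G\<^esub> v\<close> is symmetric, so that an edge is a pair of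
  opposite arcs. The graph without vertices is included.
\<close>

definition closed_nbhd :: "('a, 'b) pre_digraph \<Rightarrow> 'a set \<Rightarrow> 'a set" where
  "closed_nbhd G S = S \<union> {v. \<exists>u\<in>S. u \<rightarrow>\<^bsub>G\<^esub> v}"

definition independent_set :: "('a, 'b) pre_digraph \<Rightarrow> 'a set \<Rightarrow> bool" where
  "independent_set G S \<longleftrightarrow> S \<subseteq> verts G \<and> (\<forall>u\<in>S. \<forall>v\<in>S. \<not> u \<rightarrow>\<^bsub>G\<^esub> v)"

definition isolating_set :: "('a, 'b) pre_digraph \<Rightarrow> 'a set \<Rightarrow> bool" where
  "isolating_set G S \<longleftrightarrow> S \<subseteq> verts G \<and> arcs (G \<restriction> (verts G - closed_nbhd G S)) = {}"

definition independent_isolating_set :: "('a, 'b) pre_digraph \<Rightarrow> 'a set \<Rightarrow> bool" where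
  "independent_isolating_set G S \<longleftrightarrow> isolating_set G S \<and> independent_set G S"

definition independent_dominating_set :: "('a, 'b) pre_digraph \<Rightarrow> 'a set \<Rightarrow> bool" where
  "independent_dominating_set G S \<longleftrightarrow>
     independent_set G S \<and> (\<forall>v\<in>verts G - S. \<exists>u\<in>S. v \<rightarrow>\<^bsub>G\<^esub> u)"

end

theory Submission
  imports Defs
begin

text \<open>
  Take \<open>X\<close> maximal among all independent sets of vertices, and then \<open>Y\<close> maximal among the
  independent sets disjoint from \<open>X\<close>. By maximality \<open>X\<close> dominates the whole graph, whereas \<open>Y\<close>
  dominates every vertex outside \<open>X\<close>. Hence the vertices that escape the closed neighbourhood of
  \<open>Y\<close> all lie in the independent set \<open>X\<close>, so they span no edge. The set \<open>X\<close> is isolating for the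
  same reason, the set of escaping vertices being empty, and so the pair \<open>X\<close>, \<open>Y\<close> answers both
  claims.
\<close>

text \<open>
  A maximal independent subset of \<open>W\<close>, built greedily: a new vertex joins the set unless it already
  has a neighbour there.
\<close>

lemma (in graph) ex_independent_set_dominating_within:
  assumes "W \<subseteq> verts G"
  shows "\<exists>S\<subseteq>W. independent_set G S \<and> (\<forall>v\<in>W - S. \<exists>u\<in>S. v \<rightarrow>\<^bsub>G\<^esub> u)"
proof -
  have "finite W"
    using assms finite_verts by (rule finite_subset)
  then show ?thesis
    using assms
  proof (induction W)
    case empty
    show ?case
      by (simp add: independent_set_def)
  next
    case (insert w W)
    then obtain S where S: "S \<subseteq> W" "independent_set G S" "\<forall>v\<in>W - S. \<exists>u\<in>S. v \<rightarrow>\<^bsub>G\<^esub> u"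
      by auto
    show ?case
    proof (cases "\<exists>u\<in>S. w \<rightarrow>\<^bsub>G\<^esub> u")
      case True
      with S show ?thesis
        by (intro exI[of _ S]) auto
    next
      case False
      moreover have "\<not> w \<rightarrow>\<^bsub>G\<^esub> w"
        using adj_not_same by blast
      ultimately have "independent_set G (insert w S)"
        using S(2) insert.prems graph_symmetric unfolding independent_set_def by blast
      with S show ?thesis
        by (intro exI[of _ "insert w S"]) auto
    qed
  qed
qed

text \<open>
  An edge disjoint from the closed neighbourhood of \<open>S\<close> would have both ends in \<open>I\<close>.
\<close>

lemma (in graph) isolating_set_if_dominating_outside_independent:
  assumes "S \<subseteq> verts G" and "independent_set G I"
    and dom: "\<forall>v\<in>verts G - I - S. \<exists>u\<in>S. v \<rightarrow>\<^bsub>G\<^esub> u"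
  shows "isolating_set G S"
proof -
  have undominated: "verts G - closed_nbhd G S \<subseteq> I"
    using dom graph_symmetric unfolding closed_nbhd_def by blast
  have "e \<notin> arcs (G \<restriction> (verts G - closed_nbhd G S))" for e
  proof
    assume "e \<in> arcs (G \<restriction> (verts G - closed_nbhd G S))"
    then have "e \<in> arcs G" "tail G e \<in> I" "head G e \<in> I"
      using undominated by auto
    then show False
      using \<open>independent_set G I\<close> in_arcs_imp_in_arcs_ends unfolding independent_set_def by blast
  qed
  with \<open>S \<subseteq> verts G\<close> show ?thesis
    unfolding isolating_set_def by blast
qed

theorem lemma1:
  fixes G :: "('a, 'b) pre_digraph"
  assumes "graph G"
  shows "(\<exists>A B. A \<inter> B = {} \<and> independent_isolating_set G A \<and> independent_isolating_set G B) \<and>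
         (\<exists>X Y. X \<inter> Y = {} \<and> independent_dominating_set G X \<and> independent_isolating_set G Y)"
proof -
  interpret graph G by fact
  obtain X where X: "X \<subseteq> verts G" "independent_set G X"
      "\<forall>v\<in>verts G - X. \<exists>u\<in>X. v \<rightarrow>\<^bsub>G\<^esub> u"
    using ex_independent_set_dominating_within[of "verts G"] by blast
  obtain Y where Y: "Y \<subseteq> verts G - X" "independent_set G Y"
      "\<forall>v\<in>verts G - X - Y. \<exists>u\<in>Y. v \<rightarrow>\<^bsub>G\<^esub> u"
    using ex_independent_set_dominating_within[of "verts G - X"] by blast
  have "independent_dominating_set G X"
    using X unfolding independent_dominating_set_def by blast
  moreover have "independent_isolating_set G X"
    using X isolating_set_if_dominating_outside_independent[of X "{}"]
    unfolding independent_isolating_set_def by (simp add: independent_set_def)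
  moreover have "independent_isolating_set G Y"
    using X(2) Y isolating_set_if_dominating_outside_independent[of Y X]
    unfolding independent_isolating_set_def by blast
  moreover have "X \<inter> Y = {}"
    using Y(1) by blast
  ultimately show ?thesis
    by blast
qed

end
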